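(* Let $\kappa$ be a regular cardinal and let $\mathcal{T}$ be a countable complete first-order theory in a countable relational vocabulary $L$. Let $\eta\in\kappa^\kappa$ be such that $M_\eta\models\mathcal{T}$, and suppose that for every $\alpha<\kappa^+$ there is $\xi\in\kappa^\kappa$ such that $M_\xi\models\mathcal{T}$, $M_\xi\not\cong M_\eta$ and $M_\xi\equiv^\alpha_{\kappa^+\kappa}M_\eta$. Then $\mathrm{Orb}(M_\eta)=\{\zeta\in\kappa^\kappa\mid M_\zeta\cong M_\eta\}$ is not $\kappa$-Borel.
   Context: Coding of structures: $L=\{Q_m\mid m<\omega\}$ is a countable relational vocabulary and $\pi:\kappa^{<\omega}\to\kappa$ is a fixed bijection. For $\eta\in\kappa^\kappa$, $M_\eta$ is the $L$-structure with domain $\kappa$ in which, for $(a_1,\dots,a_n)\in\kappa^n$, $(a_1,\dots,a_n)\in Q_m^{M_\eta}$ iff $Q_m$ has arity $n$ and $\eta(\pi(m,a_1,\dots,a_n))>0$. $M\equiv^\alpha_{\kappa^+\kappa}N$ means $M$ and $N$ satisfy the same $L_{\kappa^+\kappa}$-sentences of quantifier rank at most $\alpha$. Topology: for $X\subseteq\kappa$ with $|X|<\kappa$ and $\eta:X\to\kappa$, let $N_\eta=\{\zeta\in\kappa^\kappa\mid \eta\subseteq\zeta\}$; these sets together with $\emptyset$ are the basic $\kappa$-open sets. The $\kappa$-Borel subsets of $\kappa^\kappa$ form the smallest class containing the basic $\kappa$-open sets and closed under complements, unions of at most $\kappa$ sets and intersections of at most $\kappa$ sets. *)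

theory Defs
  imports Main "HOL-Library.Countable_Set"
begin

text \<open>kappa is represented by a type 'k together with a cardinal well-order r on UNIV;
  the ordinals below kappa are the elements of 'k ordered by r.\<close>

definition regular_infinite_cardinal :: "'k rel \<Rightarrow> bool" where
  "regular_infinite_cardinal r \<longleftrightarrow>
     card_order r \<and> regularCard r \<and> infinite (UNIV :: 'k set)"

primrec nat_ord :: "'k rel \<Rightarrow> nat \<Rightarrow> 'k" where
  "nat_ord r 0 = wo_rel.minim r UNIV"
| "nat_ord r (Suc n) = wo_rel.suc r {nat_ord r n}"

text \<open>An L-structure with domain 'a: relation symbol Q_m interpreted as a predicate on
  lists of elements (only lists of length ar m are relevant). ar gives the arities.\<close>
type_synonym 'a lstruct = "nat \<Rightarrow> 'a list \<Rightarrow> bool"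

definition code_structure ::
  "'k rel \<Rightarrow> (nat \<Rightarrow> nat) \<Rightarrow> ('k list \<Rightarrow> 'k) \<Rightarrow> ('k \<Rightarrow> 'k) \<Rightarrow> 'k lstruct" where
  "code_structure r ar \<pi> \<eta> = (\<lambda>m as. length as = ar m \<and>
      \<eta> (\<pi> (nat_ord r m # as)) \<noteq> nat_ord r 0)"

definition isomorphic :: "(nat \<Rightarrow> nat) \<Rightarrow> 'a lstruct \<Rightarrow> 'b lstruct \<Rightarrow> bool" where
  "isomorphic ar M N \<longleftrightarrow> (\<exists>f. bij f \<and>
      (\<forall>m as. length as = ar m \<longrightarrow> (M m as \<longleftrightarrow> N m (map f as))))"

datatype fo_form = FEq nat nat | FRel nat "nat list" | FNeg fo_form
  | FAnd fo_form fo_form | FEx nat fo_form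

primrec fo_wf :: "(nat \<Rightarrow> nat) \<Rightarrow> fo_form \<Rightarrow> bool" where
  "fo_wf ar (FEq x y) = True"
| "fo_wf ar (FRel m xs) = (length xs = ar m)"
| "fo_wf ar (FNeg \<phi>) = fo_wf ar \<phi>"
| "fo_wf ar (FAnd \<phi> \<psi>) = (fo_wf ar \<phi> \<and> fo_wf ar \<psi>)"
| "fo_wf ar (FEx x \<phi>) = fo_wf ar \<phi>"

primrec fo_fv :: "fo_form \<Rightarrow> nat set" where
  "fo_fv (FEq x y) = {x, y}"
| "fo_fv (FRel m xs) = set xs"
| "fo_fv (FNeg \<phi>) = fo_fv \<phi>"
| "fo_fv (FAnd \<phi> \<psi>) = fo_fv \<phi> \<union> fo_fv \<psi>"
| "fo_fv (FEx x \<phi>) = fo_fv \<phi> - {x}"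

definition fo_sentence :: "(nat \<Rightarrow> nat) \<Rightarrow> fo_form \<Rightarrow> bool" where
  "fo_sentence ar \<phi> \<longleftrightarrow> fo_wf ar \<phi> \<and> fo_fv \<phi> = {}"

primrec fo_sat :: "'a lstruct \<Rightarrow> (nat \<Rightarrow> 'a) \<Rightarrow> fo_form \<Rightarrow> bool" where
  "fo_sat M s (FEq x y) = (s x = s y)"
| "fo_sat M s (FRel m xs) = M m (map s xs)"
| "fo_sat M s (FNeg \<phi>) = (\<not> fo_sat M s \<phi>)"
| "fo_sat M s (FAnd \<phi> \<psi>) = (fo_sat M s \<phi> \<and> fo_sat M s \<psi>)"
| "fo_sat M s (FEx x \<phi>) = (\<exists>a. fo_sat M (s(x := a)) \<phi>)"

definition fo_model :: "'a lstruct \<Rightarrow> fo_form set \<Rightarrow> bool" where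
  "fo_model M T \<longleftrightarrow> (\<forall>\<phi>\<in>T. \<forall>s. fo_sat M s \<phi>)"

text \<open>A complete theory: a set of L-sentences containing, for every L-sentence,
  it or its negation (consistency is supplied separately by a model).\<close>
definition complete_theory :: "(nat \<Rightarrow> nat) \<Rightarrow> fo_form set \<Rightarrow> bool" where
  "complete_theory ar T \<longleftrightarrow> (\<forall>\<phi>\<in>T. fo_sentence ar \<phi>) \<and>
     (\<forall>\<phi>. fo_sentence ar \<phi> \<longrightarrow> \<phi> \<in> T \<or> FNeg \<phi> \<in> T)"

text \<open>Variables and conjunction indices range over 'k (kappa many); conjunctions
  of at most kappa formulas are conjunctions indexed by 'k (with repetitions);
  quantifier blocks bind sets of fewer than kappa variables (enforced by inf_wf).\<close>
datatype ('i, 'v) inf_form = IEq 'v 'v | IRel nat "'v list" | INeg "('i, 'v) inf_form"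
  | IConj "'i \<Rightarrow> ('i, 'v) inf_form" | IEx "'v set" "('i, 'v) inf_form"

primrec inf_wf :: "'k rel \<Rightarrow> (nat \<Rightarrow> nat) \<Rightarrow> ('k, 'k) inf_form \<Rightarrow> bool" where
  "inf_wf r ar (IEq x y) = True"
| "inf_wf r ar (IRel m xs) = (length xs = ar m)"
| "inf_wf r ar (INeg \<phi>) = inf_wf r ar \<phi>"
| "inf_wf r ar (IConj f) = (\<forall>i. inf_wf r ar (f i))"
| "inf_wf r ar (IEx X \<phi>) = ((card_of X, r) \<in> ordLess \<and> inf_wf r ar \<phi>)"

primrec inf_fv :: "('i, 'v) inf_form \<Rightarrow> 'v set" where
  "inf_fv (IEq x y) = {x, y}"
| "inf_fv (IRel m xs) = set xs"
| "inf_fv (INeg \<phi>) = inf_fv \<phi>"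
| "inf_fv (IConj f) = (\<Union>i. inf_fv (f i))"
| "inf_fv (IEx X \<phi>) = inf_fv \<phi> - X"

primrec inf_sat :: "'a lstruct \<Rightarrow> ('v \<Rightarrow> 'a) \<Rightarrow> ('i, 'v) inf_form \<Rightarrow> bool" where
  "inf_sat M s (IEq x y) = (s x = s y)"
| "inf_sat M s (IRel m xs) = M m (map s xs)"
| "inf_sat M s (INeg \<phi>) = (\<not> inf_sat M s \<phi>)"
| "inf_sat M s (IConj f) = (\<forall>i. inf_sat M s (f i))"
| "inf_sat M s (IEx X \<phi>) = (\<exists>s'. (\<forall>v. v \<notin> X \<longrightarrow> s' v = s v) \<and> inf_sat M s' \<phi>)"

text \<open>Ordinals below kappa^+ are the elements of Field (cardSuc r), ordered by cardSuc r.
  qr_le q \<phi> \<alpha> means: the quantifier rank of \<phi> is at most \<alpha>, where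
  qr(atomic)=0, qr(neg \<phi>)=qr \<phi>, qr(conj)=sup, qr(exists X \<phi>)=qr \<phi>+1.\<close>
primrec qr_le :: "'o rel \<Rightarrow> ('i, 'v) inf_form \<Rightarrow> 'o \<Rightarrow> bool" where
  "qr_le q (IEq x y) \<alpha> = True"
| "qr_le q (IRel m xs) \<alpha> = True"
| "qr_le q (INeg \<phi>) \<alpha> = qr_le q \<phi> \<alpha>"
| "qr_le q (IConj f) \<alpha> = (\<forall>i. qr_le q (f i) \<alpha>)"
| "qr_le q (IEx X \<phi>) \<alpha> = (\<exists>\<beta>. (\<beta>, \<alpha>) \<in> q \<and> \<beta> \<noteq> \<alpha> \<and> qr_le q \<phi> \<beta>)"

definition inf_sentence :: "'k rel \<Rightarrow> (nat \<Rightarrow> nat) \<Rightarrow> ('k, 'k) inf_form \<Rightarrow> bool" where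
  "inf_sentence r ar \<phi> \<longleftrightarrow> inf_wf r ar \<phi> \<and> inf_fv \<phi> = {}"

definition equiv_rank :: "'k rel \<Rightarrow> (nat \<Rightarrow> nat) \<Rightarrow> 'k set \<Rightarrow> 'k lstruct \<Rightarrow> 'k lstruct \<Rightarrow> bool" where
  "equiv_rank r ar \<alpha> M N \<longleftrightarrow> (\<forall>\<phi>. inf_sentence r ar \<phi> \<and> qr_le (cardSuc r) \<phi> \<alpha> \<longrightarrow>
      ((\<forall>s. inf_sat M s \<phi>) \<longleftrightarrow> (\<forall>s. inf_sat N s \<phi>)))"

definition basic_open :: "('k \<rightharpoonup> 'k) \<Rightarrow> ('k \<Rightarrow> 'k) set" where
  "basic_open p = {\<zeta>. \<forall>x\<in>dom p. p x = Some (\<zeta> x)}"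

inductive_set kappa_borel :: "'k rel \<Rightarrow> ('k \<Rightarrow> 'k) set set" for r :: "'k rel" where
  basic: "(card_of (dom (p :: 'k \<rightharpoonup> 'k)), r) \<in> ordLess \<Longrightarrow> basic_open p \<in> kappa_borel r"
| empty: "{} \<in> kappa_borel r"
| compl: "A \<in> kappa_borel r \<Longrightarrow> - A \<in> kappa_borel r"
| union: "(\<And>i::'k. F i \<in> kappa_borel r) \<Longrightarrow> (\<Union>i. F i) \<in> kappa_borel r"
| inter: "(\<And>i::'k. F i \<in> kappa_borel r) \<Longrightarrow> (\<Inter>i. F i) \<in> kappa_borel r"

end

theory Submission
  imports Defs
begin

text \<open>This is the hard direction of the Vaught transform, with forcing in place of category. Force
  with injections of initial segments \<open>\<beta> < \<kappa>\<close> into \<open>\<kappa>\<close>; a generic filter is a bijection \<open>f\<close> of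
  \<open>\<kappa>\<close>, and it yields a code of the copy of a structure \<open>M\<close> along \<open>f\<close>. By recursion on a Borel set
  \<open>A\<close>, the relation ``the tuple \<open>(x_i)_{i<\<beta>}\<close> forces the copy to lie in \<open>A\<close>'' is defined in \<open>M\<close>
  by an \<open>L_{\<kappa>^+ \<kappa>}\<close> formula whose quantifier rank is below \<open>\<kappa>^+\<close> and does not depend on \<open>M\<close>.
  As the domains are initial segments, \<open>\<kappa>\<close> conjuncts suffice without assuming
  \<open>\<kappa>^{<\<kappa>} = \<kappa>\<close>, and as \<open>\<kappa>\<close> is regular, \<open>\<kappa>\<close> many dense sets can be met. If the orbit of \<open>M_\<eta>\<close>
  were Borel, then ``some condition forces the copy into the orbit'' would be a sentence of rank below
  \<open>\<kappa>^+\<close> which holds in \<open>M_\<eta>\<close>, hence also in some \<open>M_\<xi>\<close> not isomorphic to \<open>M_\<eta>\<close>; a generic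
  bijection through such a condition for \<open>M_\<xi>\<close> shows \<open>M_\<xi> \<cong> M_\<eta>\<close>, a contradiction.\<close>

unbundle cardinal_syntax

section \<open>Well-orders of regular cardinals\<close>

text \<open>By regularity a set smaller than \<open>q\<close> is not cofinal, so it has no element
  strictly above some \<open>a\<close>; by totality this \<open>a\<close> bounds it.\<close>

lemma regularCard_bounded:
  assumes "Card_order q" "regularCard q" "K \<subseteq> Field q" "|K| <o q"
  shows "\<exists>a\<in>Field q. \<forall>b\<in>K. (b, a) \<in> q"
proof -
  have wo: "Well_order q" using assms(1) by (simp add: card_order_on_def)
  then have tot: "total_on (Field q) q" and rf: "refl_on (Field q) q"
    by (auto simp: order_on_defs)
  have "\<not> cofinal K q"
    using assms not_ordLess_ordIso unfolding regularCard_def by blast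
  then show ?thesis
    using tot rf assms(3) unfolding cofinal_def total_on_def refl_on_def by (metis subsetD)
qed

locale regular_cardinal =
  fixes r :: "'k rel"
  assumes reg: "regular_infinite_cardinal r"
begin

lemma Card_order_r: "Card_order r"
  and Field_r [simp]: "Field r = UNIV"
  and regularCard_r: "regularCard r"
  and infinite_UNIV_k: "infinite (UNIV :: 'k set)"
  using reg card_order_on_Card_order[of UNIV r]
  unfolding regular_infinite_cardinal_def by auto

lemma Well_order_r: "Well_order r"
  using Card_order_r by (simp add: card_order_on_def)

lemma wo_rel_r: "wo_rel r"
  using Well_order_r by (simp add: wo_rel_def)

lemma le_refl [simp]: "(a, a) \<in> r"
  using wo_rel.REFL[OF wo_rel_r] by (auto simp: refl_on_def)

lemma le_trans: "(a, b) \<in> r \<Longrightarrow> (b, c) \<in> r \<Longrightarrow> (a, c) \<in> r"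
  using wo_rel.TRANS[OF wo_rel_r] by (meson transD)

lemma le_antisym: "(a, b) \<in> r \<Longrightarrow> (b, a) \<in> r \<Longrightarrow> a = b"
  using wo_rel.ANTISYM[OF wo_rel_r] by (meson antisymD)

lemma le_total: "(a, b) \<in> r \<or> (b, a) \<in> r"
  using wo_rel.TOTALS[OF wo_rel_r] by auto

lemma not_le_iff: "(a, b) \<notin> r \<longleftrightarrow> b \<in> underS r a"
  using le_total le_antisym unfolding underS_def by auto

lemma underS_mono: "(a, b) \<in> r \<Longrightarrow> underS r a \<subseteq> underS r b"
  using le_trans le_antisym unfolding underS_def by blast

lemma wf_less: "wf (r - Id)"
  using wo_rel.WF[OF wo_rel_r] .

lemma ex_greater: "\<exists>b. a \<in> underS r b"
  using infinite_Card_order_limit[OF Card_order_r, of a] infinite_UNIV_k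
  by (auto simp: underS_def)

lemma UNIV_ordIso: "|UNIV :: 'k set| =o r"
  using card_of_Field_ordIso[OF Card_order_r] by simp

lemma card_underS: "|underS r a| <o r"
  using card_of_underS[OF Card_order_r, of a] by simp

lemma finite_card_ordLess: "finite X \<Longrightarrow> |X| <o r"
  by (rule finite_ordLess_infinite[OF card_of_Well_order Well_order_r])
    (simp_all add: infinite_UNIV_k card_of_Field_ordIso Field_card_of)

lemma bounded: "|K| <o r \<Longrightarrow> \<exists>a. \<forall>b\<in>K. (b, a) \<in> r"
  using regularCard_bounded[OF Card_order_r regularCard_r, of K] by simp

text \<open>Take \<beta> least outside \<open>U\<close>. This turns unions of domains of conditions
  back into domains of conditions.\<close>

lemma down_closed_eq_underS:
  assumes "U \<noteq> UNIV" and dc: "\<And>x y. x \<in> U \<Longrightarrow> (y, x) \<in> r \<Longrightarrow> y \<in> U"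
  obtains \<beta> where "U = underS r \<beta>"
proof -
  obtain \<beta> where b: "\<beta> \<in> - U" "\<And>y. (y, \<beta>) \<in> r - Id \<Longrightarrow> y \<notin> - U"
    using wfE_min[OF wf_less] assms(1) by (metis ComplI UNIV_eq_I)
  have "U = underS r \<beta>"
  proof (intro set_eqI iffI)
    fix x assume "x \<in> U"
    then show "x \<in> underS r \<beta>" using b(1) dc not_le_iff by blast
  next
    fix x assume "x \<in> underS r \<beta>"
    then show "x \<in> U" using b(2) by (auto simp: underS_def)
  qed
  then show ?thesis by (rule that)
qed

section \<open>The finite ordinals inside \<kappa>\<close>

lemma nat_ord_less_Suc: "nat_ord r n \<in> underS r (nat_ord r (Suc n))"
proof -
  \<comment> \<open>\<open>suc\<close> is the minimum of the strict upper bounds, so one has to be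
    exhibited first.\<close>
  obtain b where "nat_ord r n \<in> underS r b" using ex_greater by blast
  then have "b \<in> AboveS r {nat_ord r n}" by (auto simp: AboveS_def underS_def)
  then have ne: "AboveS r {nat_ord r n} \<noteq> {}" by auto
  have "wo_rel.suc r {nat_ord r n} \<noteq> nat_ord r n \<and> (nat_ord r n, wo_rel.suc r {nat_ord r n}) \<in> r"
    by (rule wo_rel.suc_greater[OF wo_rel_r _ ne]) simp_all
  then show ?thesis by (auto simp: underS_def)
qed

lemma nat_ord_less: "m < n \<Longrightarrow> nat_ord r m \<in> underS r (nat_ord r n)"
proof (induction n)
  case (Suc n)
  have "(nat_ord r n, nat_ord r (Suc n)) \<in> r"
    using nat_ord_less_Suc by (auto simp: underS_def)
  then show ?case
    using Suc nat_ord_less_Suc[of n] underS_mono less_Suc_eq by blast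
qed simp

text \<open>Hence the relation symbol can be read off a coded atomic fact, and the code values 0 and
  1 differ.\<close>

lemma nat_ord_inject [simp]: "nat_ord r m = nat_ord r n \<longleftrightarrow> m = n"
  using nat_ord_less[of m n] nat_ord_less[of n m]
  by (metis underS_notIn nat_neq_iff)

lemma underS_nat_ord_0: "underS r (nat_ord r 0) = {}"
  using wo_rel.minim_least[OF wo_rel_r, of UNIV] not_le_iff by fastforce

section \<open>Ordinals below the successor cardinal\<close>

lemma Card_order_cardSuc: "Card_order (cardSuc r)"
  using cardSuc_Card_order[OF Card_order_r] .

lemma wo_rel_cardSuc: "wo_rel (cardSuc r)"
  using Card_order_cardSuc by (simp add: card_order_on_def wo_rel_def)

lemma infinite_Field_cardSuc: "infinite (Field (cardSuc r))"
  using cardSuc_finite[OF Card_order_r] infinite_UNIV_k by simp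

lemma cardSuc_greater:
  "a \<in> Field (cardSuc r) \<Longrightarrow> \<exists>b\<in>Field (cardSuc r). a \<noteq> b \<and> (a, b) \<in> cardSuc r"
  using infinite_Card_order_limit[OF Card_order_cardSuc infinite_Field_cardSuc] .

text \<open>This is the regularity of \<kappa>^+. It gives a common rank bound to the \<kappa> many
  formulas that come from a union of Borel sets.\<close>

lemma cardSuc_bounded_range:
  fixes g :: "'k \<Rightarrow> 'k set"
  assumes "\<And>i. g i \<in> Field (cardSuc r)"
  shows "\<exists>a\<in>Field (cardSuc r). \<forall>i. (g i, a) \<in> cardSuc r"
proof -
  have "|range g| \<le>o |UNIV :: 'k set|" by (rule card_of_image)
  also have "|UNIV :: 'k set| =o r" by (rule UNIV_ordIso)
  also have "r <o cardSuc r" using Card_order_r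
    by (rule BNF_Cardinal_Order_Relation.cardSuc_greater)
  finally have "|range g| <o cardSuc r" .
  moreover have "regularCard (cardSuc r)"
    using infinite_cardSuc_regularCard[OF _ Card_order_r] infinite_UNIV_k by simp
  ultimately show ?thesis
    using regularCard_bounded[OF Card_order_cardSuc, of "range g"] assms by auto
qed

lemma qr_le_mono:
  "qr_le (cardSuc r) \<phi> a \<Longrightarrow> (a, b) \<in> cardSuc r \<Longrightarrow> qr_le (cardSuc r) \<phi> b"
proof (induction \<phi>)
  case (IEx X \<phi>)
  then obtain c where c: "(c, a) \<in> cardSuc r" "c \<noteq> a" "qr_le (cardSuc r) \<phi> c" by auto
  have "(c, b) \<in> cardSuc r"
    using c(1) IEx.prems(2) wo_rel.TRANS[OF wo_rel_cardSuc] by (meson transD)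
  moreover have "c \<noteq> b"
    using c IEx.prems(2) wo_rel.ANTISYM[OF wo_rel_cardSuc] by (meson antisymD)
  ultimately show ?case using c(3) by auto
qed auto

section \<open>Generic bijections\<close>

text \<open>A forcing condition is a pair of an ordinal \<open>\<beta>\<close> and a function injective on \<open>\<beta>\<close>, of which
  only the restriction to \<open>\<beta>\<close> matters.\<close>

definition ext :: "'k \<Rightarrow> ('k \<Rightarrow> 'k) \<Rightarrow> 'k \<Rightarrow> ('k \<Rightarrow> 'k) \<Rightarrow> bool" where
  "ext \<beta> s \<gamma> t \<longleftrightarrow>
     (\<beta>, \<gamma>) \<in> r \<and> (\<forall>x\<in>underS r \<beta>. t x = s x) \<and> inj_on t (underS r \<gamma>)"

definition dense :: "('k \<Rightarrow> ('k \<Rightarrow> 'k) \<Rightarrow> bool) \<Rightarrow> bool" where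
  "dense D \<longleftrightarrow> (\<forall>\<beta> s. inj_on s (underS r \<beta>) \<longrightarrow> (\<exists>\<gamma> t. ext \<beta> s \<gamma> t \<and> D \<gamma> t))"

text \<open>Conditions are represented by total functions of which only a restriction counts, so a
  genuine set of conditions must ignore the rest. This is what passes membership from a condition to
  the generic function extending it.\<close>

definition local :: "('k \<Rightarrow> ('k \<Rightarrow> 'k) \<Rightarrow> bool) \<Rightarrow> bool" where
  "local D \<longleftrightarrow> (\<forall>\<gamma> s t. (\<forall>x\<in>underS r \<gamma>. s x = t x) \<longrightarrow> D \<gamma> s \<longrightarrow> D \<gamma> t)"

lemma ext_refl: "inj_on s (underS r \<beta>) \<Longrightarrow> ext \<beta> s \<beta> s"
  by (simp add: ext_def)

lemma ext_trans: "ext \<beta> s \<gamma> t \<Longrightarrow> ext \<gamma> t \<delta> u \<Longrightarrow> ext \<beta> s \<delta> u"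
  using le_trans underS_mono unfolding ext_def by (metis subsetD)

lemma ext_same: "bij f \<Longrightarrow> (\<beta>, \<gamma>) \<in> r \<Longrightarrow> ext \<beta> f \<gamma> f"
  by (auto simp: ext_def bij_def intro: inj_on_subset)

text \<open>Members of a chain agree where both are defined, so their union is a function. Any two
  points of its domain lie in the domain of the longer of two members, whence injectivity.\<close>

lemma chain_glue:
  assumes chain: "\<And>c d. c \<in> C \<Longrightarrow> d \<in> C \<Longrightarrow>
      ext (fst c) (snd c) (fst d) (snd d) \<or> ext (fst d) (snd d) (fst c) (snd c)"
  shows "\<exists>s. inj_on s (\<Union>c\<in>C. underS r (fst c)) \<and> (\<forall>c\<in>C. \<forall>x\<in>underS r (fst c). s x = snd c x)"
proof -
  define s where "s x = snd (SOME c. c \<in> C \<and> x \<in> underS r (fst c)) x" for x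
  have agree: "snd c x = snd d x"
    if "c \<in> C" "d \<in> C" "x \<in> underS r (fst c)" "x \<in> underS r (fst d)" for c d x
    using chain[OF that(1,2)] that(3,4) unfolding ext_def by auto
  have s: "s x = snd c x" if "c \<in> C" "x \<in> underS r (fst c)" for c x
  proof -
    have "(SOME c. c \<in> C \<and> x \<in> underS r (fst c)) \<in> C \<and>
        x \<in> underS r (fst (SOME c. c \<in> C \<and> x \<in> underS r (fst c)))"
      by (rule someI[of _ c]) (use that in simp)
    then show ?thesis unfolding s_def using agree that by blast
  qed
  have "inj_on s (\<Union>c\<in>C. underS r (fst c))"
  proof (rule inj_onI)
    fix x y assume "x \<in> (\<Union>c\<in>C. underS r (fst c))" "y \<in> (\<Union>c\<in>C. underS r (fst c))"
      and eq: "s x = s y"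
    then obtain c d where c: "c \<in> C" "x \<in> underS r (fst c)" and d: "d \<in> C" "y \<in> underS r (fst d)"
      by blast
    have "\<exists>e\<in>C. x \<in> underS r (fst e) \<and> y \<in> underS r (fst e) \<and> inj_on (snd e) (underS r (fst e))"
      using chain[OF c(1) d(1)] c d underS_mono unfolding ext_def by blast
    then show "x = y" using s eq by (metis inj_onD)
  qed
  then show ?thesis using s by blast
qed

text \<open>A value not yet taken is assigned to the first free argument \<beta>. Meeting all these
  sets makes the generic function surjective.\<close>

lemma dense_in_range: "dense (\<lambda>\<gamma> t. a \<in> t ` underS r \<gamma>)"
  unfolding dense_def
proof (intro allI impI)
  fix \<beta> and s :: "'k \<Rightarrow> 'k"
  assume inj: "inj_on s (underS r \<beta>)"
  show "\<exists>\<gamma> t. ext \<beta> s \<gamma> t \<and> a \<in> t ` underS r \<gamma>"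
  proof (cases "a \<in> s ` underS r \<beta>")
    case True
    then show ?thesis using ext_refl[OF inj] by blast
  next
    case False
    let ?U = "insert \<beta> (underS r \<beta>)" and ?t = "s(\<beta> := a)"
    have nb: "\<beta> \<notin> underS r \<beta>" by (simp add: underS_def)
    \<comment> \<open>As \<kappa> has no greatest element, adding \<beta> to the domain leaves a
      proper initial segment; the \<gamma> obtained below is \<beta> + 1.\<close>
    obtain b where b: "\<beta> \<in> underS r b" using ex_greater by blast
    then have "b \<notin> ?U"
      by (metis insertE not_le_iff underS_notIn le_refl le_total)
    then have "?U \<noteq> UNIV" by auto
    moreover have "y \<in> ?U" if "x \<in> ?U" "(y, x) \<in> r" for x y
      using that by (auto simp: underS_def dest: le_trans le_antisym)
    ultimately obtain \<gamma> where g: "?U = underS r \<gamma>" by (rule down_closed_eq_underS) auto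
    have "(\<beta>, \<gamma>) \<in> r" using g by (auto simp: underS_def)
    moreover have "inj_on ?t ?U" using inj False nb by (auto simp: inj_on_def)
    ultimately have "ext \<beta> s \<gamma> ?t" using nb g by (auto simp: ext_def)
    moreover have "a \<in> ?t ` underS r \<gamma>" using g[symmetric] by auto
    ultimately show ?thesis by blast
  qed
qed

lemma local_in_range: "local (\<lambda>\<gamma> t. a \<in> t ` underS r \<gamma>)"
  by (auto simp: local_def image_iff)

text \<open>The dense sets, together with those for surjectivity, are enumerated along \<kappa> and
  met one after the other by an increasing sequence of conditions of length \<kappa>. Its union is
  the bijection, and locality carries each dense set over to it.\<close>

theorem generic_bijection:
  assumes card: "|\<D>| \<le>o r"
    and dense: "\<And>D. D \<in> \<D> \<Longrightarrow> dense D" and local: "\<And>D. D \<in> \<D> \<Longrightarrow> local D"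
    and inj: "inj_on s (underS r \<beta>)"
  shows "\<exists>f. bij f \<and> (\<forall>x\<in>underS r \<beta>. f x = s x) \<and> (\<forall>D\<in>\<D>. \<exists>\<gamma>. D \<gamma> f)"
proof -
  let ?R = "range (\<lambda>a \<gamma> t. a \<in> t ` underS r \<gamma>) :: ('k \<Rightarrow> ('k \<Rightarrow> 'k) \<Rightarrow> bool) set"
  let ?E = "\<D> \<union> ?R"
  have "|?R| \<le>o r"
    using card_of_image[of _ UNIV] UNIV_ordIso ordLeq_ordIso_trans by blast
  then have "|?E| \<le>o r"
    using card card_of_Un_ordLeq_infinite_Field[of r] infinite_UNIV_k Card_order_r by simp
  then have "|?E| \<le>o |UNIV :: 'k set|"
    using UNIV_ordIso ordIso_symmetric ordLeq_ordIso_trans by blast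
  then obtain d :: "'k \<Rightarrow> 'k \<Rightarrow> ('k \<Rightarrow> 'k) \<Rightarrow> bool" where d: "range d = ?E"
    using card_of_ordLeq2[of ?E "UNIV :: 'k set"] by blast
  have "dense D \<and> local D" if "D \<in> ?E" for D
    using that dense local dense_in_range local_in_range by auto
  then have dd: "dense (d i)" "local (d i)" for i
    using d by (metis rangeI)+
  \<comment> \<open>At stage \<open>i\<close> the condition \<open>c\<close> has to extend the
    starting condition and all earlier choices and to lie in the dense set with index
    \<open>i\<close>.\<close>
  define P where "P g i c \<longleftrightarrow> ext \<beta> s (fst c) (snd c) \<and>
      (\<forall>j\<in>underS r i. ext (fst (g j)) (snd (g j)) (fst c) (snd c)) \<and> d i (fst c) (snd c)"
    for g :: "'k \<Rightarrow> 'k \<times> ('k \<Rightarrow> 'k)" and i c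
  have "\<exists>g. \<forall>i. P g i (g i)"
  proof (rule dependent_wf_choice[OF wf_less])
    fix f g :: "'k \<Rightarrow> 'k \<times> ('k \<Rightarrow> 'k)" and i c
    assume "\<And>z. (z, i) \<in> r - Id \<Longrightarrow> f z = g z"
    then have "\<And>z. z \<in> underS r i \<Longrightarrow> f z = g z" by (auto simp: underS_def)
    then show "P f i c = P g i c" unfolding P_def by simp
  next
    fix i and g :: "'k \<Rightarrow> 'k \<times> ('k \<Rightarrow> 'k)"
    assume "\<And>y. (y, i) \<in> r - Id \<Longrightarrow> P g y (g y)"
    then have IH: "\<And>j. j \<in> underS r i \<Longrightarrow> P g j (g j)" by (auto simp: underS_def)
    \<comment> \<open>The starting condition is listed too, since the least stage has no
      predecessor.\<close>
    let ?C = "insert (\<beta>, s) (g ` underS r i)"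
    let ?U = "\<Union>c\<in>?C. underS r (fst c)"
    have inj_g: "inj_on (snd c) (underS r (fst c))" if "c \<in> ?C" for c
      using that inj IH unfolding P_def ext_def by auto
    have chain: "ext (fst c) (snd c) (fst e) (snd e) \<or> ext (fst e) (snd e) (fst c) (snd c)"
      if ce: "c \<in> ?C" "e \<in> ?C" for c e
    proof -
      consider "c = e" | "c = (\<beta>, s)" "e \<in> g ` underS r i" | "e = (\<beta>, s)" "c \<in> g ` underS r i"
        | j k where "j \<in> underS r i" "k \<in> underS r i" "c = g j" "e = g k" "j \<noteq> k"
        using ce by blast
      then show ?thesis
      proof cases
        case 1 then show ?thesis using ext_refl inj_g ce by blast
      next
        case 2 then show ?thesis using IH by (auto simp: P_def)
      next
        case 3 then show ?thesis using IH by (auto simp: P_def)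
      next
        case 4
        then have "j \<in> underS r k \<or> k \<in> underS r j" using le_total by (auto simp: underS_def)
        then show ?thesis using IH 4 by (auto simp: P_def)
      qed
    qed
    obtain t where "inj_on t ?U \<and> (\<forall>c\<in>?C. \<forall>x\<in>underS r (fst c). t x = snd c x)"
      using chain_glue[OF chain] ..
    then have t: "inj_on t ?U" "\<And>c x. c \<in> ?C \<Longrightarrow> x \<in> underS r (fst c) \<Longrightarrow> t x = snd c x"
      by blast+
    \<comment> \<open>Fewer than \<kappa> stages precede \<open>i\<close>, so by regularity the
      domains are bounded and the glued function is again a condition.\<close>
    have "|(fst \<circ> g) ` underS r i| <o r"
      using card_of_image card_underS ordLeq_ordLess_trans by blast
    then obtain a where a: "\<And>j. j \<in> underS r i \<Longrightarrow> (fst (g j), a) \<in> r"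
      using bounded by fastforce
    obtain b where b: "(a, b) \<in> r" "(\<beta>, b) \<in> r" using le_total le_refl by blast
    have "(fst c, b) \<in> r" if "c \<in> ?C" for c
      using that a b le_trans by auto
    then have "b \<notin> ?U" using not_le_iff by blast
    then have "?U \<noteq> UNIV" by blast
    moreover have "y \<in> ?U" if "x \<in> ?U" "(y, x) \<in> r" for x y
      using that by (auto simp: underS_def dest: le_trans le_antisym)
    ultimately obtain \<gamma> where g: "?U = underS r \<gamma>" by (rule down_closed_eq_underS)
    have up: "ext (fst c) (snd c) \<gamma> t" if "c \<in> ?C" for c
    proof -
      have "underS r (fst c) \<subseteq> underS r \<gamma>" using that g by blast
      then have "(fst c, \<gamma>) \<in> r" by (metis not_le_iff subsetD underS_notIn)
      then show ?thesis using t that g unfolding ext_def by simp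
    qed
    obtain \<delta> u where u: "ext \<gamma> t \<delta> u" "d i \<delta> u"
      using dd(1)[of i] t(1) g unfolding dense_def by metis
    have "ext (fst c) (snd c) \<delta> u" if "c \<in> ?C" for c
      using ext_trans[OF up[OF that] u(1)] .
    from this[of "(\<beta>, s)"] this have "P g i (\<delta>, u)"
      using u(2) by (simp add: P_def)
    then show "\<exists>c. P g i c" by blast
  qed
  then obtain g where g: "\<And>i. P g i (g i)" by blast
  let ?U = "\<Union>c\<in>range g. underS r (fst c)"
  have "ext (fst (g i)) (snd (g i)) (fst (g j)) (snd (g j)) \<or>
      ext (fst (g j)) (snd (g j)) (fst (g i)) (snd (g i))" for i j
  proof (cases "i = j")
    case True
    then show ?thesis using g[of i] by (auto simp: P_def ext_def)
  next
    case False
    then have "i \<in> underS r j \<or> j \<in> underS r i" using le_total by (auto simp: underS_def)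
    then show ?thesis using g by (auto simp: P_def)
  qed
  then have chain: "ext (fst c) (snd c) (fst e) (snd e) \<or> ext (fst e) (snd e) (fst c) (snd c)"
    if "c \<in> range g" "e \<in> range g" for c e
    using that by auto
  obtain f where "inj_on f ?U \<and> (\<forall>c\<in>range g. \<forall>x\<in>underS r (fst c). f x = snd c x)"
    using chain_glue[OF chain] ..
  then have f: "inj_on f ?U"
    "\<And>c x. c \<in> range g \<Longrightarrow> x \<in> underS r (fst c) \<Longrightarrow> f x = snd c x"
    by blast+
  have D: "d i (fst (g i)) f" for i
  proof -
    have "\<And>x. x \<in> underS r (fst (g i)) \<Longrightarrow> snd (g i) x = f x"
      using f(2)[OF rangeI, symmetric] .
    then show ?thesis using dd(2)[of i] g[of i] unfolding P_def local_def by blast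
  qed
  have surj: "f ` ?U = UNIV"
  proof (intro set_eqI iffI UNIV_I)
    fix a
    have "(\<lambda>\<gamma> t. a \<in> t ` underS r \<gamma>) \<in> range d" unfolding d by blast
    then obtain i where "(\<lambda>\<gamma> t. a \<in> t ` underS r \<gamma>) = d i" by blast
    then have "a \<in> f ` underS r (fst (g i))" using D[of i] by metis
    then show "a \<in> f ` ?U" by blast
  qed
  \<comment> \<open>A proper initial segment has fewer than \<kappa> elements, but \<open>f\<close>
    maps the union of the domains onto \<kappa>.\<close>
  have "?U = UNIV"
  proof (rule ccontr)
    assume "?U \<noteq> UNIV"
    moreover have "y \<in> ?U" if "x \<in> ?U" "(y, x) \<in> r" for x y
      using that by (auto simp: underS_def dest: le_trans le_antisym)
    ultimately obtain \<gamma> where "?U = underS r \<gamma>" by (rule down_closed_eq_underS)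
    then have "|UNIV :: 'k set| \<le>o |underS r \<gamma>|"
      using surj card_of_image by metis
    then have "|UNIV :: 'k set| <o r" using card_underS ordLeq_ordLess_trans by blast
    then show False using UNIV_ordIso not_ordLess_ordIso by blast
  qed
  then have "bij f" using f(1) surj by (simp add: bij_def)
  moreover have "f x = s x" if "x \<in> underS r \<beta>" for x
  proof -
    \<comment> \<open>Every stage extends the starting condition; \<open>x\<close> merely serves as
      an index.\<close>
    have e: "ext \<beta> s (fst (g x)) (snd (g x))" using g by (simp add: P_def)
    then have "x \<in> underS r (fst (g x))" using that underS_mono unfolding ext_def by blast
    then show ?thesis using f(2)[of "g x" x] e that unfolding ext_def by simp
  qed
  moreover have "\<exists>\<gamma>. D \<gamma> f" if "D \<in> \<D>" for D
  proof -
    have "D \<in> range d" using that d by blast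
    then show ?thesis using D by blast
  qed
  ultimately show ?thesis by blast
qed

end

section \<open>Formulas defining the forcing relation\<close>

lemma inf_sat_cong:
  "(\<And>v. v \<in> inf_fv \<phi> \<Longrightarrow> s v = t v) \<Longrightarrow> inf_sat M s \<phi> \<longleftrightarrow> inf_sat M t \<phi>"
proof (induction \<phi> arbitrary: s t)
  case (IRel m xs)
  then have "map s xs = map t xs" by simp
  then show ?case by (metis inf_sat.simps(2))
next
  case (IConj f)
  have "inf_sat M s (f i) = inf_sat M t (f i)" for i
    by (rule IConj.IH) (use IConj.prems in auto)
  then show ?case by simp
next
  case (IEx X \<phi>)
  have half: "inf_sat M t (IEx X \<phi>)"
    if st: "\<And>v. v \<in> inf_fv \<phi> - X \<Longrightarrow> s v = t v" and sat: "inf_sat M s (IEx X \<phi>)" for s t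
  proof -
    obtain s' where s': "\<forall>v. v \<notin> X \<longrightarrow> s' v = s v" "inf_sat M s' \<phi>" using sat by auto
    let ?t = "\<lambda>v. if v \<in> X then s' v else t v"
    have "inf_sat M s' \<phi> = inf_sat M ?t \<phi>" by (rule IEx.IH) (use s' st in auto)
    then have "(\<forall>v. v \<notin> X \<longrightarrow> ?t v = t v) \<and> inf_sat M ?t \<phi>" using s' by simp
    then show ?thesis unfolding inf_sat.simps(5) by (rule exI[of _ ?t])
  qed
  have "\<And>v. v \<in> inf_fv \<phi> - X \<Longrightarrow> s v = t v" using IEx.prems by simp
  then show ?case using half[of s t] half[of t s] by metis
next
  case (INeg \<phi>)
  have "inf_sat M s \<phi> = inf_sat M t \<phi>" by (rule INeg.IH) (use INeg.prems in simp)
  then show ?case by simp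
qed auto

text \<open>There are no sentences of rank 0 unless some relation symbol is nullary.\<close>

definition ITrue :: "('i, 'v) inf_form" where
  "ITrue = IEx {undefined} (IEq undefined undefined)"

lemma ITrue_simps [simp]: "inf_sat M s ITrue" "inf_fv ITrue = {}"
  by (auto simp: ITrue_def)

context regular_cardinal
begin

lemma ITrue_wf [simp]: "inf_wf r ar ITrue"
proof -
  have "|{undefined :: 'k}| <o r"
    by (simp add: finite_card_ordLess)
  then show ?thesis by (simp add: ITrue_def)
qed

text \<open>Pairs that impose no inequality carry \<phi> itself, and the diagonal ensures that
  \<phi> occurs. As a filler it keeps the quantifier rank, which \<open>ITrue\<close> could
  raise.\<close>

definition IInj :: "'k \<Rightarrow> ('k, 'k) inf_form \<Rightarrow> ('k, 'k) inf_form" where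
  "IInj \<gamma> \<phi> = IConj (\<lambda>i. IConj (\<lambda>j.
     if i \<in> underS r \<gamma> \<and> j \<in> underS r \<gamma> \<and> i \<noteq> j then INeg (IEq i j) else \<phi>))"

lemma IInj_simps:
  "inf_sat M s (IInj \<gamma> \<phi>) \<longleftrightarrow> inj_on s (underS r \<gamma>) \<and> inf_sat M s \<phi>"
  "inf_wf r ar (IInj \<gamma> \<phi>) \<longleftrightarrow> inf_wf r ar \<phi>"
  "qr_le q (IInj \<gamma> \<phi>) \<alpha> \<longleftrightarrow> qr_le q \<phi> \<alpha>"
  "inf_fv \<phi> \<subseteq> underS r \<gamma> \<Longrightarrow> inf_fv (IInj \<gamma> \<phi>) \<subseteq> underS r \<gamma>"
  by (auto simp: IInj_def inj_on_def split: if_splits)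

text \<open>Conjunctions are indexed by all of \<open>\<kappa>\<close>, so indices below \<open>\<beta>\<close> are sent to \<open>\<beta>\<close>.\<close>

definition IForceNeg :: "('k \<Rightarrow> ('k, 'k) inf_form) \<Rightarrow> 'k \<Rightarrow> ('k, 'k) inf_form" where
  "IForceNeg \<Phi> \<beta> = IConj (\<lambda>\<gamma>'. let \<gamma> = if (\<beta>, \<gamma>') \<in> r then \<gamma>' else \<beta> in
     INeg (IEx (underS r \<gamma> - underS r \<beta>) (IInj \<gamma> (\<Phi> \<gamma>))))"

text \<open>This is the forcing clause for negation: no extension forces \<Phi>. The quantified
  block leaves the tuple below \<beta> fixed, and \<open>IInj\<close> makes the new tuple a
  condition.\<close>

lemma IForceNeg_sat:
  assumes fv: "\<And>\<gamma>. inf_fv (\<Phi> \<gamma>) \<subseteq> underS r \<gamma>"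
  shows "inf_sat M s (IForceNeg \<Phi> \<beta>) \<longleftrightarrow> (\<forall>\<gamma> t. ext \<beta> s \<gamma> t \<longrightarrow> \<not> inf_sat M t (\<Phi> \<gamma>))"
proof -
  have key: "inf_sat M s (IEx (underS r \<gamma> - underS r \<beta>) (IInj \<gamma> (\<Phi> \<gamma>))) \<longleftrightarrow>
      (\<exists>t. ext \<beta> s \<gamma> t \<and> inf_sat M t (\<Phi> \<gamma>))" if bg: "(\<beta>, \<gamma>) \<in> r" for \<gamma>
  proof
    assume "inf_sat M s (IEx (underS r \<gamma> - underS r \<beta>) (IInj \<gamma> (\<Phi> \<gamma>)))"
    then show "\<exists>t. ext \<beta> s \<gamma> t \<and> inf_sat M t (\<Phi> \<gamma>)"
      using bg by (auto simp: IInj_simps ext_def)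
  next
    assume "\<exists>t. ext \<beta> s \<gamma> t \<and> inf_sat M t (\<Phi> \<gamma>)"
    then obtain t where t: "ext \<beta> s \<gamma> t" "inf_sat M t (\<Phi> \<gamma>)" by blast
    \<comment> \<open>An extension may differ from \<open>s\<close> outside \<gamma>, whereas the
      quantifier changes only its block. Restoring \<open>s\<close> there is invisible to a formula
      with free variables below \<gamma>.\<close>
    let ?t = "\<lambda>v. if v \<in> underS r \<gamma> - underS r \<beta> then t v else s v"
    have eq: "t v = ?t v" if "v \<in> underS r \<gamma>" for v
      using that t(1) by (auto simp: ext_def)
    have "inf_sat M ?t (\<Phi> \<gamma>)"
      using inf_sat_cong[of "\<Phi> \<gamma>" t ?t M] eq fv t(2) by blast
    moreover have "inj_on ?t (underS r \<gamma>)"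
      using t(1) inj_on_cong[of "underS r \<gamma>" t ?t] eq unfolding ext_def by blast
    ultimately have "(\<forall>v. v \<notin> underS r \<gamma> - underS r \<beta> \<longrightarrow> ?t v = s v) \<and>
        inf_sat M ?t (IInj \<gamma> (\<Phi> \<gamma>))" by (simp add: IInj_simps(1))
    then show "inf_sat M s (IEx (underS r \<gamma> - underS r \<beta>) (IInj \<gamma> (\<Phi> \<gamma>)))"
      unfolding inf_sat.simps(5) by (rule exI[of _ ?t])
  qed
  let ?up = "\<lambda>\<gamma>. if (\<beta>, \<gamma>) \<in> r then \<gamma> else \<beta>"
  have up: "(\<beta>, ?up \<gamma>) \<in> r" for \<gamma> by simp
  have "inf_sat M s (IForceNeg \<Phi> \<beta>) \<longleftrightarrow> (\<forall>\<gamma>. \<not> (\<exists>t. ext \<beta> s (?up \<gamma>) t \<and> inf_sat M t (\<Phi> (?up \<gamma>))))"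
    unfolding IForceNeg_def inf_sat.simps(3,4) Let_def by (simp only: key[OF up])
  also have "\<dots> \<longleftrightarrow> (\<forall>\<gamma> t. ext \<beta> s \<gamma> t \<longrightarrow> \<not> inf_sat M t (\<Phi> \<gamma>))"
  proof (intro iffI allI impI)
    fix \<gamma> t assume *: "\<forall>\<gamma>. \<not> (\<exists>t. ext \<beta> s (?up \<gamma>) t \<and> inf_sat M t (\<Phi> (?up \<gamma>)))"
      and e: "ext \<beta> s \<gamma> t"
    have "?up \<gamma> = \<gamma>" using e by (simp add: ext_def)
    then show "\<not> inf_sat M t (\<Phi> \<gamma>)" using *[rule_format, of \<gamma>] e by auto
  qed simp
  finally show ?thesis .
qed

lemma IForceNeg_wf: "(\<And>\<gamma>. inf_wf r ar (\<Phi> \<gamma>)) \<Longrightarrow> inf_wf r ar (IForceNeg \<Phi> \<beta>)"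
proof -
  assume wf: "\<And>\<gamma>. inf_wf r ar (\<Phi> \<gamma>)"
  have "|underS r \<gamma> - underS r \<beta>| <o r" for \<gamma>
    by (rule ordLeq_ordLess_trans[OF card_of_mono1 card_underS[of \<gamma>]]) blast
  then show ?thesis using wf by (simp add: IForceNeg_def Let_def IInj_simps)
qed

lemma IForceNeg_fv:
  assumes "\<And>\<gamma>. inf_fv (\<Phi> \<gamma>) \<subseteq> underS r \<gamma>"
  shows "inf_fv (IForceNeg \<Phi> \<beta>) \<subseteq> underS r \<beta>"
proof -
  have "inf_fv (IInj \<gamma> (\<Phi> \<gamma>)) - (underS r \<gamma> - underS r \<beta>) \<subseteq> underS r \<beta>" for \<gamma>
    using IInj_simps(4)[OF assms, of \<gamma>] by blast
  then show ?thesis by (simp add: IForceNeg_def Let_def UN_subset_iff)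
qed

text \<open>Exactly one quantifier block is put in front of \<Phi>, whatever \<beta> is, so one
  strict step of rank serves all \<beta>.\<close>

lemma IForceNeg_qr:
  assumes "\<And>\<gamma>. qr_le q (\<Phi> \<gamma>) \<alpha>" "(\<alpha>, \<alpha>') \<in> q" "\<alpha> \<noteq> \<alpha>'"
  shows "qr_le q (IForceNeg \<Phi> \<beta>) \<alpha>'"
proof -
  have "\<exists>\<alpha>. (\<alpha>, \<alpha>') \<in> q \<and> \<alpha> \<noteq> \<alpha>' \<and> qr_le q (\<Phi> \<gamma>) \<alpha>" for \<gamma>
    using assms by blast
  then show ?thesis by (simp add: IForceNeg_def Let_def IInj_simps(3))
qed

end

section \<open>The forcing theorem for Borel sets\<close>

text \<open>The copy of \<open>M\<close> along \<open>f\<close>: for bijective \<open>f\<close> it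
  is the structure that \<open>f\<close> maps isomorphically onto \<open>M\<close>.\<close>

definition pull :: "'a lstruct \<Rightarrow> ('b \<Rightarrow> 'a) \<Rightarrow> 'b lstruct" where
  "pull M f = (\<lambda>m as. M m (map f as))"

locale coding = regular_cardinal r for r :: "'k rel" +
  fixes ar :: "nat \<Rightarrow> nat" and \<pi> :: "'k list \<Rightarrow> 'k"
  assumes bij_pi: "bij \<pi>"
begin

text \<open>A structure has many codes, differing in the positive values and at arguments of \<open>\<eta>\<close> that
  code no atomic fact; fixing one makes every subbasic set a literal of the structure.\<close>

definition can_code :: "'k lstruct \<Rightarrow> 'k \<Rightarrow> 'k" where
  "can_code M x = (if \<exists>m as. x = \<pi> (nat_ord r m # as) \<and> length as = ar m \<and> M m as
     then nat_ord r 1 else nat_ord r 0)"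

lemma pi_eq_iff [simp]: "\<pi> xs = \<pi> ys \<longleftrightarrow> xs = ys"
  using bij_pi by (auto simp: bij_def inj_def)

lemma nat_ord_1_neq_0: "nat_ord r 1 \<noteq> nat_ord r 0"
  using nat_ord_inject[of 1 0] by (simp del: nat_ord.simps)

lemma can_code_pi:
  "length as = ar m \<Longrightarrow>
     can_code M (\<pi> (nat_ord r m # as)) = (if M m as then nat_ord r 1 else nat_ord r 0)"
  by (auto simp del: nat_ord.simps simp: can_code_def)

lemma code_structure_can_code:
  "code_structure r ar \<pi> (can_code M) = (\<lambda>m as. length as = ar m \<and> M m as)"
  using nat_ord_1_neq_0
  by (simp add: code_structure_def fun_eq_iff can_code_pi del: nat_ord.simps cong: conj_cong)

definition generic_for where
  "generic_for \<D> f \<longleftrightarrow> bij f \<and> (\<forall>D\<in>\<D>. \<exists>\<beta>. D \<beta> f)"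

text \<open>The truth lemma of forcing: if \<open>f\<close> meets suitable dense sets, at most
  \<kappa> many, then its copy lies in \<open>A\<close> iff some initial segment of \<open>f\<close>
  forces this. The dense sets may depend on \<open>M\<close>.\<close>

definition truth_lemma ::
  "'k lstruct \<Rightarrow> ('k \<Rightarrow> 'k) set \<Rightarrow> ('k \<Rightarrow> ('k, 'k) inf_form) \<Rightarrow> bool" where
  "truth_lemma M A \<Phi> \<longleftrightarrow> (\<exists>\<D>. |\<D>| \<le>o r \<and> (\<forall>D\<in>\<D>. dense D \<and> local D) \<and>
     (\<forall>f. generic_for \<D> f \<longrightarrow>
        (can_code (pull M f) \<in> A \<longleftrightarrow> (\<exists>\<beta>. inf_sat M f (\<Phi> \<beta>)))))"

lemma truth_lemmaI:
  assumes "|\<D>| \<le>o r" "\<And>D. D \<in> \<D> \<Longrightarrow> dense D \<and> local D"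
    "\<And>f. generic_for \<D> f \<Longrightarrow> can_code (pull M f) \<in> A \<longleftrightarrow> (\<exists>\<beta>. inf_sat M f (\<Phi> \<beta>))"
  shows "truth_lemma M A \<Phi>"
  unfolding truth_lemma_def by (rule exI[of _ \<D>]) (simp add: assms)

lemma truth_lemmaE:
  assumes "truth_lemma M A \<Phi>"
  obtains \<D> where "|\<D>| \<le>o r" "\<And>D. D \<in> \<D> \<Longrightarrow> dense D \<and> local D"
    "\<And>f. generic_for \<D> f \<Longrightarrow> can_code (pull M f) \<in> A \<longleftrightarrow> (\<exists>\<beta>. inf_sat M f (\<Phi> \<beta>))"
  using assms unfolding truth_lemma_def by (elim exE conjE) simp

text \<open>\<open>\<Phi> \<beta>\<close> speaks about the tuple of length \<beta> that forms a
  condition. The family \<Phi> and the rank bound \<alpha> are chosen before \<open>M\<close>; this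
  uniformity allows statements about forcing to be transferred between structures.\<close>

definition forcing_formula ::
  "('k \<Rightarrow> 'k) set \<Rightarrow> ('k \<Rightarrow> ('k, 'k) inf_form) \<Rightarrow> 'k set \<Rightarrow> bool" where
  "forcing_formula A \<Phi> \<alpha> \<longleftrightarrow> \<alpha> \<in> Field (cardSuc r) \<and>
     (\<forall>\<beta>. inf_wf r ar (\<Phi> \<beta>)) \<and> (\<forall>\<beta>. inf_fv (\<Phi> \<beta>) \<subseteq> underS r \<beta>) \<and>
     (\<forall>\<beta>. qr_le (cardSuc r) (\<Phi> \<beta>) \<alpha>) \<and>
     (\<forall>M \<beta> s \<gamma> t. ext \<beta> s \<gamma> t \<longrightarrow> inf_sat M s (\<Phi> \<beta>) \<longrightarrow> inf_sat M t (\<Phi> \<gamma>)) \<and>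
     (\<forall>M. truth_lemma M A \<Phi>)"

lemma forcing_formulaI:
  assumes "\<alpha> \<in> Field (cardSuc r)" "\<And>\<beta>. inf_wf r ar (\<Phi> \<beta>)"
    "\<And>\<beta>. inf_fv (\<Phi> \<beta>) \<subseteq> underS r \<beta>" "\<And>\<beta>. qr_le (cardSuc r) (\<Phi> \<beta>) \<alpha>"
    "\<And>M \<beta> s \<gamma> t. ext \<beta> s \<gamma> t \<Longrightarrow> inf_sat M s (\<Phi> \<beta>) \<Longrightarrow> inf_sat M t (\<Phi> \<gamma>)"
    "\<And>M. truth_lemma M A \<Phi>"
  shows "forcing_formula A \<Phi> \<alpha>"
  using assms unfolding forcing_formula_def by blast

lemma forcing_formulaD:
  assumes "forcing_formula A \<Phi> \<alpha>"
  shows "\<alpha> \<in> Field (cardSuc r)" "\<And>\<beta>. inf_wf r ar (\<Phi> \<beta>)"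
    "\<And>\<beta>. inf_fv (\<Phi> \<beta>) \<subseteq> underS r \<beta>" "\<And>\<beta>. qr_le (cardSuc r) (\<Phi> \<beta>) \<alpha>"
    "\<And>M \<beta> s \<gamma> t. ext \<beta> s \<gamma> t \<Longrightarrow> inf_sat M s (\<Phi> \<beta>) \<Longrightarrow> inf_sat M t (\<Phi> \<gamma>)"
    "\<And>M. truth_lemma M A \<Phi>"
  using assms unfolding forcing_formula_def by blast+

section \<open>Forcing membership in subbasic sets\<close>

lemma card_empty_le: "|{}| \<le>o r"
  by (simp add: finite_card_ordLess ordLess_imp_ordLeq)

lemma ITrue_qr:
  "\<exists>\<alpha>\<in>Field (cardSuc r). qr_le (cardSuc r) (ITrue :: ('k, 'k) inf_form) \<alpha>"
proof -
  obtain \<beta> where "\<beta> \<in> Field (cardSuc r)"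
    using infinite_imp_nonempty[OF infinite_Field_cardSuc] by blast
  then obtain \<alpha> where "\<alpha> \<in> Field (cardSuc r)" "\<beta> \<noteq> \<alpha>" "(\<beta>, \<alpha>) \<in> cardSuc r"
    using cardSuc_greater by blast
  then show ?thesis by (auto simp: ITrue_def)
qed

text \<open>If the answer is the same for all canonical codes, all conditions force it or none does,
  and there is no dense set to meet.\<close>

lemma forcing_formula_const:
  assumes "\<And>(M :: 'k lstruct) f. can_code (pull M f) \<in> A \<longleftrightarrow> b"
  shows "\<exists>\<Phi> \<alpha>. forcing_formula A \<Phi> \<alpha>"
proof -
  obtain \<alpha> where \<alpha>: "\<alpha> \<in> Field (cardSuc r)" "qr_le (cardSuc r) (ITrue :: ('k, 'k) inf_form) \<alpha>"
    using ITrue_qr by blast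
  have "forcing_formula A (\<lambda>_. if b then ITrue else INeg ITrue) \<alpha>"
    by (rule forcing_formulaI)
      (use \<alpha> assms card_empty_le in \<open>auto split: if_splits intro!: truth_lemmaI[of "{}"]\<close>)
  then show ?thesis by blast
qed

lemma finite_subset_underS:
  assumes "finite X"
  obtains \<beta> where "X \<subseteq> underS r \<beta>"
proof -
  obtain a where a: "\<And>x. x \<in> X \<Longrightarrow> (x, a) \<in> r"
    using bounded[OF finite_card_ordLess[OF assms]] by blast
  obtain b where b: "a \<in> underS r b" using ex_greater by blast
  have "X \<subseteq> underS r b"
    using a b by (auto simp: underS_def dest: le_trans le_antisym)
  then show ?thesis by (rule that)
qed

text \<open>A condition settles the literal once its domain contains the finitely many variables;
  shorter conditions receive a false formula.\<close>

lemma forcing_formula_literal: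
  assumes wf: "inf_wf r ar \<phi>" and qr: "\<And>\<alpha>. qr_le (cardSuc r) \<phi> \<alpha>" and fin: "finite (inf_fv \<phi>)"
    and A: "\<And>(M :: 'k lstruct) f. can_code (pull M f) \<in> A \<longleftrightarrow> inf_sat M f \<phi>"
  shows "\<exists>\<Phi> \<alpha>. forcing_formula A \<Phi> \<alpha>"
proof -
  obtain \<alpha> where \<alpha>: "\<alpha> \<in> Field (cardSuc r)" "qr_le (cardSuc r) (ITrue :: ('k, 'k) inf_form) \<alpha>"
    using ITrue_qr by blast
  define \<Phi> where "\<Phi> \<beta> = (if inf_fv \<phi> \<subseteq> underS r \<beta> then \<phi> else INeg ITrue)" for \<beta>
  obtain \<beta> where \<beta>: "inf_fv \<phi> \<subseteq> underS r \<beta>" using finite_subset_underS[OF fin] .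
  have "forcing_formula A \<Phi> \<alpha>"
  proof (rule forcing_formulaI)
    fix M :: "'k lstruct" and \<beta> s \<gamma> t assume e: "ext \<beta> s \<gamma> t" and "inf_sat M s (\<Phi> \<beta>)"
    then have fv: "inf_fv \<phi> \<subseteq> underS r \<beta>" and sat: "inf_sat M s \<phi>"
      by (auto simp: \<Phi>_def split: if_splits)
    have "inf_sat M t \<phi>"
      using sat inf_sat_cong[of \<phi> s t M] fv e unfolding ext_def by fastforce
    moreover have "inf_fv \<phi> \<subseteq> underS r \<gamma>"
      using fv e underS_mono unfolding ext_def by blast
    ultimately show "inf_sat M t (\<Phi> \<gamma>)" by (simp add: \<Phi>_def)
  next
    fix M :: "'k lstruct"
    have "(\<exists>\<beta>. inf_sat M f (\<Phi> \<beta>)) \<longleftrightarrow> inf_sat M f \<phi>" for f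
      using \<beta> by (auto simp: \<Phi>_def)
    then show "truth_lemma M A \<Phi>"
      using A card_empty_le by (intro truth_lemmaI[of "{}"]) simp_all
  qed (use \<alpha> wf qr in \<open>auto simp: \<Phi>_def\<close>)
  then show ?thesis by blast
qed

text \<open>Canonical codes take only the values 0 and 1. Where \<open>x\<close> codes an atomic
  fact, the value 1 is that fact, 0 its negation, and any other value is impossible; elsewhere the
  value is constantly 0.\<close>

lemma forcing_formula_atom: "\<exists>\<Phi> \<alpha>. forcing_formula {\<zeta>. \<zeta> x = y} \<Phi> \<alpha>"
proof (cases "\<exists>m as. x = \<pi> (nat_ord r m # as) \<and> length as = ar m")
  case False
  then have "can_code M x = nat_ord r 0" for M by (auto simp: can_code_def simp del: nat_ord.simps)
  then show ?thesis by (intro forcing_formula_const[of _ "nat_ord r 0 = y"]) simp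
next
  case True
  then obtain m as where x: "x = \<pi> (nat_ord r m # as)" and len: "length as = ar m" by blast
  have code: "can_code (pull M f) x = (if M m (map f as) then nat_ord r 1 else nat_ord r 0)"
    for M :: "'k lstruct" and f
    unfolding x can_code_pi[OF len] by (simp add: pull_def)
  consider "y = nat_ord r 1" | "y = nat_ord r 0" | "y \<noteq> nat_ord r 1" "y \<noteq> nat_ord r 0" by blast
  then show ?thesis
  proof cases
    case 1
    then show ?thesis using nat_ord_1_neq_0 len
      by (intro forcing_formula_literal[of "IRel m as"]) (auto simp: code simp del: nat_ord.simps One_nat_def)
  next
    case 2
    then show ?thesis using nat_ord_1_neq_0 len
      by (intro forcing_formula_literal[of "INeg (IRel m as)"]) (auto simp: code simp del: nat_ord.simps One_nat_def)
  next
    case 3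
    then show ?thesis by (intro forcing_formula_const[of _ False]) (auto simp: code simp del: nat_ord.simps One_nat_def)
  qed
qed

section \<open>Complements, unions and intersections\<close>

text \<open>A condition that does not force the complement has an extension forcing
  \<open>A\<close>, so the conditions deciding \<open>A\<close> are dense. No bijection has initial
  segments deciding both ways, since these are compatible.\<close>

lemma forcing_formula_compl:
  assumes F: "forcing_formula A \<Phi> \<alpha>" and \<alpha>': "(\<alpha>, \<alpha>') \<in> cardSuc r" "\<alpha> \<noteq> \<alpha>'"
  shows "forcing_formula (- A) (IForceNeg \<Phi>) \<alpha>'"
proof -
  note F = forcing_formulaD[OF F]
  note sat = IForceNeg_sat[where \<Phi> = \<Phi>, OF F(3)]
  show ?thesis
  proof (rule forcing_formulaI)
    show "\<alpha>' \<in> Field (cardSuc r)" using \<alpha>' by (auto intro: FieldI2)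
  next
    fix M \<beta> s \<gamma> t assume "ext \<beta> s \<gamma> t" "inf_sat M s (IForceNeg \<Phi> \<beta>)"
    then show "inf_sat M t (IForceNeg \<Phi> \<gamma>)" unfolding sat using ext_trans by blast
  next
    fix M :: "'k lstruct"
    obtain \<D> where D: "|\<D>| \<le>o r" "\<And>D. D \<in> \<D> \<Longrightarrow> dense D \<and> local D"
      "\<And>f. generic_for \<D> f \<Longrightarrow> can_code (pull M f) \<in> A \<longleftrightarrow> (\<exists>\<beta>. inf_sat M f (\<Phi> \<beta>))"
      using truth_lemmaE[OF F(6)[of M]] by blast
    \<comment> \<open>The conditions that decide \<open>A\<close>.\<close>
    define E where "E \<gamma> t \<longleftrightarrow> inf_sat M t (\<Phi> \<gamma>) \<or> inf_sat M t (IForceNeg \<Phi> \<gamma>)" for \<gamma> t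
    have "dense E" unfolding dense_def
    proof (intro allI impI)
      fix \<beta> and s :: "'k \<Rightarrow> 'k"
      assume "inj_on s (underS r \<beta>)"
      then show "\<exists>\<gamma> t. ext \<beta> s \<gamma> t \<and> E \<gamma> t"
        using ext_refl sat[of M s \<beta>] unfolding E_def by blast
    qed
    moreover have "local E" unfolding local_def
    proof (intro allI impI)
      fix \<gamma> s t assume st: "\<forall>x\<in>underS r \<gamma>. s x = t x" and "E \<gamma> s"
      moreover have "inf_sat M s (\<Phi> \<gamma>) = inf_sat M t (\<Phi> \<gamma>)"
        by (rule inf_sat_cong) (use st F(3) in blast)
      moreover have "inf_sat M s (IForceNeg \<Phi> \<gamma>) = inf_sat M t (IForceNeg \<Phi> \<gamma>)"
        by (rule inf_sat_cong) (use st IForceNeg_fv[of \<Phi>, OF F(3)] in blast)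
      ultimately show "E \<gamma> t" by (simp add: E_def)
    qed
    moreover have "|insert E \<D>| \<le>o r"
    proof -
      have "|{E}| \<le>o r"
        using finite_card_ordLess ordLess_imp_ordLeq by blast
      then show ?thesis
        using card_of_Un_ordLeq_infinite_Field[of r "{E}" \<D>] infinite_UNIV_k Card_order_r D(1) by simp
    qed
    moreover have "can_code (pull M f) \<in> - A \<longleftrightarrow> (\<exists>\<beta>. inf_sat M f (IForceNeg \<Phi> \<beta>))"
      if f: "generic_for (insert E \<D>) f" for f
    proof -
      have bij: "bij f" and A: "can_code (pull M f) \<in> A \<longleftrightarrow> (\<exists>\<beta>. inf_sat M f (\<Phi> \<beta>))"
        using f D(3)[of f] by (auto simp: generic_for_def)
      have "\<exists>\<gamma>. E \<gamma> f" using f by (auto simp: generic_for_def)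
      moreover have False if "inf_sat M f (\<Phi> \<beta>)" "inf_sat M f (IForceNeg \<Phi> \<gamma>)" for \<beta> \<gamma>
      proof -
        obtain \<delta> where d: "(\<beta>, \<delta>) \<in> r" "(\<gamma>, \<delta>) \<in> r" using le_total le_refl by blast
        then have "inf_sat M f (\<Phi> \<delta>)" using F(5) ext_same[OF bij] that(1) by blast
        then show False using that(2) ext_same[OF bij d(2)] unfolding sat by blast
      qed
      ultimately show ?thesis using A unfolding E_def by blast
    qed
    ultimately show "truth_lemma M (- A) (IForceNeg \<Phi>)"
      using D(2) by (intro truth_lemmaI[of "insert E \<D>"]) blast+
  qed (fact IForceNeg_wf[OF F(2)] IForceNeg_fv[OF F(3)] IForceNeg_qr[OF F(4) \<alpha>'])+
qed

lemma ex_forcing_formula_compl: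
  assumes "\<exists>\<Phi> \<alpha>. forcing_formula A \<Phi> \<alpha>"
  shows "\<exists>\<Phi> \<alpha>. forcing_formula (- A) \<Phi> \<alpha>"
proof -
  obtain \<Phi> \<alpha> where F: "forcing_formula A \<Phi> \<alpha>" using assms by blast
  obtain \<alpha>' where "(\<alpha>, \<alpha>') \<in> cardSuc r" "\<alpha> \<noteq> \<alpha>'"
    using cardSuc_greater[OF forcing_formulaD(1)[OF F]] by blast
  then show ?thesis using forcing_formula_compl[OF F] by blast
qed

text \<open>Strong forcing is used: a condition forces the union iff it forces a member. The
  disjunction costs no quantifier, and the truth lemma holds for any \<open>f\<close> generic for
  all members at once.\<close>

lemma ex_forcing_formula_UN:
  fixes F :: "'k \<Rightarrow> ('k \<Rightarrow> 'k) set"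
  assumes "\<And>i. \<exists>\<Phi> \<alpha>. forcing_formula (F i) \<Phi> \<alpha>"
  shows "\<exists>\<Phi> \<alpha>. forcing_formula (\<Union>i. F i) \<Phi> \<alpha>"
proof -
  obtain \<Phi> \<alpha> where FF: "\<And>i. forcing_formula (F i) (\<Phi> i) (\<alpha> i)" using assms by metis
  note F = forcing_formulaD[OF FF]
  obtain \<alpha>' where \<alpha>': "\<alpha>' \<in> Field (cardSuc r)" "\<And>i. (\<alpha> i, \<alpha>') \<in> cardSuc r"
    using cardSuc_bounded_range[of \<alpha>] F(1) by blast
  define \<Psi> where "\<Psi> \<beta> = INeg (IConj (\<lambda>i. INeg (\<Phi> i \<beta>)))" for \<beta>
  have sat: "inf_sat M s (\<Psi> \<beta>) \<longleftrightarrow> (\<exists>i. inf_sat M s (\<Phi> i \<beta>))" for M :: "'k lstruct" and s \<beta>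
    by (simp add: \<Psi>_def)
  have "forcing_formula (\<Union>i. F i) \<Psi> \<alpha>'"
  proof (rule forcing_formulaI)
    fix M \<beta> s \<gamma> t assume "ext \<beta> s \<gamma> t" "inf_sat M s (\<Psi> \<beta>)"
    then show "inf_sat M t (\<Psi> \<gamma>)" unfolding sat using F(5) by blast
  next
    fix \<beta> show "qr_le (cardSuc r) (\<Psi> \<beta>) \<alpha>'"
      using qr_le_mono[OF F(4) \<alpha>'(2)] by (simp add: \<Psi>_def)
  next
    fix M :: "'k lstruct"
    obtain \<D> where "\<forall>i. |\<D> i| \<le>o r \<and> (\<forall>D\<in>\<D> i. dense D \<and> local D) \<and> (\<forall>f. generic_for (\<D> i) f \<longrightarrow>
          (can_code (pull M f) \<in> F i \<longleftrightarrow> (\<exists>\<beta>. inf_sat M f (\<Phi> i \<beta>))))"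
      using choice[of "\<lambda>i \<D>. |\<D>| \<le>o r \<and> (\<forall>D\<in>\<D>. dense D \<and> local D) \<and> (\<forall>f. generic_for \<D> f \<longrightarrow>
          (can_code (pull M f) \<in> F i \<longleftrightarrow> (\<exists>\<beta>. inf_sat M f (\<Phi> i \<beta>))))"]
        F(6)[where M = M, unfolded truth_lemma_def] by iprover
    then have D: "\<And>i. |\<D> i| \<le>o r" "\<And>i D. D \<in> \<D> i \<Longrightarrow> dense D \<and> local D"
      "\<And>i f. generic_for (\<D> i) f \<Longrightarrow> can_code (pull M f) \<in> F i \<longleftrightarrow> (\<exists>\<beta>. inf_sat M f (\<Phi> i \<beta>))"
      by simp_all
    have "|\<Union>i. \<D> i| \<le>o r"
      by (rule card_of_UNION_ordLeq_infinite_Field[OF _ Card_order_r])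
        (simp_all add: infinite_UNIV_k D(1) ordIso_imp_ordLeq[OF UNIV_ordIso])
    moreover have "can_code (pull M f) \<in> (\<Union>i. F i) \<longleftrightarrow> (\<exists>\<beta>. inf_sat M f (\<Psi> \<beta>))"
      if "generic_for (\<Union>i. \<D> i) f" for f
    proof -
      have "generic_for (\<D> i) f" for i using that by (auto simp: generic_for_def)
      then have "can_code (pull M f) \<in> F i \<longleftrightarrow> (\<exists>\<beta>. inf_sat M f (\<Phi> i \<beta>))" for i
        using D(3) by blast
      then show ?thesis unfolding sat by blast
    qed
    ultimately show "truth_lemma M (\<Union>i. F i) \<Psi>"
      using D(2) by (intro truth_lemmaI[of "\<Union>i. \<D> i"]) blast+
  qed (use F(1-3) \<alpha>'(1) in \<open>simp_all add: \<Psi>_def UN_subset_iff\<close>)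
  then show ?thesis by blast
qed

lemma ex_forcing_formula_INT:
  fixes F :: "'k \<Rightarrow> ('k \<Rightarrow> 'k) set"
  assumes "\<And>i. \<exists>\<Phi> \<alpha>. forcing_formula (F i) \<Phi> \<alpha>"
  shows "\<exists>\<Phi> \<alpha>. forcing_formula (\<Inter>i. F i) \<Phi> \<alpha>"
proof -
  have "(\<Inter>i. F i) = - (\<Union>i. - F i)" by auto
  moreover have "\<exists>\<Phi> \<alpha>. forcing_formula (- (\<Union>i. - F i)) \<Phi> \<alpha>"
    by (intro ex_forcing_formula_compl ex_forcing_formula_UN assms)
  ultimately show ?thesis by simp
qed

theorem kappa_borel_forcing_formula:
  "A \<in> kappa_borel r \<Longrightarrow> \<exists>\<Phi> \<alpha>. forcing_formula A \<Phi> \<alpha>"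
proof (induction rule: kappa_borel.induct)
  case (basic p)
  \<comment> \<open>A basic open set is written as an intersection indexed by \<kappa>, with
    \<open>UNIV\<close> at the points outside the domain of \<open>p\<close>.\<close>
  have "basic_open p = (\<Inter>x. if x \<in> dom p then {\<zeta>. \<zeta> x = the (p x)} else UNIV)"
  proof (rule set_eqI)
    fix \<zeta>
    have "p x = Some (\<zeta> x) \<longleftrightarrow> \<zeta> x = the (p x)" if "x \<in> dom p" for x using that by auto
    moreover have "\<zeta> \<in> (\<Inter>x. if x \<in> dom p then {\<zeta>. \<zeta> x = the (p x)} else UNIV) \<longleftrightarrow>
        (\<forall>x. x \<in> dom p \<longrightarrow> \<zeta> x = the (p x))"
      unfolding INT_iff by simp
    ultimately show "\<zeta> \<in> basic_open p \<longleftrightarrow>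
        \<zeta> \<in> (\<Inter>x. if x \<in> dom p then {\<zeta>. \<zeta> x = the (p x)} else UNIV)"
      unfolding basic_open_def by blast
  qed
  moreover have "\<exists>\<Phi> \<alpha>. forcing_formula (if x \<in> dom p then {\<zeta>. \<zeta> x = the (p x)} else UNIV) \<Phi> \<alpha>" for x
    using forcing_formula_atom forcing_formula_const[of UNIV True] by auto
  then have "\<exists>\<Phi> \<alpha>. forcing_formula (\<Inter>x. if x \<in> dom p then {\<zeta>. \<zeta> x = the (p x)} else UNIV) \<Phi> \<alpha>"
    by (rule ex_forcing_formula_INT)
  ultimately show ?case by (simp only:)
next
  case empty
  show ?case by (rule forcing_formula_const[of _ False]) simp
next
  case (compl A)
  show ?case by (rule ex_forcing_formula_compl) (rule compl.IH)
next
  case (union F)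
  show ?case by (rule ex_forcing_formula_UN) (rule union.IH)
next
  case (inter F)
  show ?case by (rule ex_forcing_formula_INT) (rule inter.IH)
qed

section \<open>Orbits\<close>

lemma isomorphic_pull:
  assumes "bij f"
  shows "isomorphic ar (code_structure r ar \<pi> (can_code (pull M f))) M"
  unfolding isomorphic_def code_structure_can_code pull_def
  by (rule exI[of _ f]) (simp add: assms)

text \<open>The coded copy is isomorphic to \<open>M\<close> by \<open>f\<close>, so an isomorphism
  \<open>h\<close> from the copy to \<open>N\<close> gives \<open>h \<circ> inv f\<close>.\<close>

lemma isomorphic_of_pull:
  assumes "bij f" "isomorphic ar (code_structure r ar \<pi> (can_code (pull M f))) N"
  shows "isomorphic ar M N"
proof -
  obtain h where "bij h \<and> (\<forall>m as. length as = ar m \<longrightarrow>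
      (length as = ar m \<and> M m (map f as) \<longleftrightarrow> N m (map h as)))"
    using assms(2) unfolding isomorphic_def code_structure_can_code pull_def ..
  then have h: "bij h" "\<And>m as. length as = ar m \<Longrightarrow> M m (map f as) \<longleftrightarrow> N m (map h as)"
    by simp_all
  have "M m as \<longleftrightarrow> N m (map (h \<circ> inv f) as)" if "length as = ar m" for m as
  proof -
    have "f \<circ> inv f = id" using assms(1) by (metis bij_def surj_iff)
    then have "map f (map (inv f) as) = as" by simp
    then show ?thesis using h(2)[of "map (inv f) as" m] that by simp
  qed
  moreover have "bij (h \<circ> inv f)" using h(1) assms(1) bij_comp bij_imp_bij_inv by blast
  ultimately show ?thesis
    unfolding isomorphic_def by (intro exI[of _ "h \<circ> inv f"]) simp
qed

end

section \<open>Transfer of a forcing statement between two structures\<close>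

theorem theorem4p5:
  fixes r :: "'k rel" and ar :: "nat \<Rightarrow> nat" and \<pi> :: "'k list \<Rightarrow> 'k"
    and T :: "fo_form set" and \<eta> :: "'k \<Rightarrow> 'k"
  assumes kappa: "regular_infinite_cardinal r"
    and pi: "bij \<pi>"
    and T: "countable T" "complete_theory ar T"
    and eta: "fo_model (code_structure r ar \<pi> \<eta>) T"
    and approx: "\<forall>\<alpha>\<in>Field (cardSuc r). \<exists>\<xi>.
        fo_model (code_structure r ar \<pi> \<xi>) T \<and>
        \<not> isomorphic ar (code_structure r ar \<pi> \<xi>) (code_structure r ar \<pi> \<eta>) \<and>
        equiv_rank r ar \<alpha> (code_structure r ar \<pi> \<xi>) (code_structure r ar \<pi> \<eta>)"
  shows "{\<zeta>. isomorphic ar (code_structure r ar \<pi> \<zeta>) (code_structure r ar \<pi> \<eta>)}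
           \<notin> kappa_borel r"
proof
  interpret coding r ar \<pi> by unfold_locales (fact kappa, fact pi)
  let ?N = "code_structure r ar \<pi> \<eta>"
  let ?A = "{\<zeta>. isomorphic ar (code_structure r ar \<pi> \<zeta>) ?N}"
  assume "?A \<in> kappa_borel r"
  then obtain \<Phi> \<alpha> where FF: "forcing_formula ?A \<Phi> \<alpha>" using kappa_borel_forcing_formula by blast
  note F = forcing_formulaD[OF FF]
  \<comment> \<open>One step above \<alpha> leaves room for the quantifier of
    \<open>IForceNeg\<close>.\<close>
  obtain \<alpha>' where \<alpha>': "\<alpha>' \<in> Field (cardSuc r)" "\<alpha> \<noteq> \<alpha>'" "(\<alpha>, \<alpha>') \<in> cardSuc r"
    using cardSuc_greater[OF F(1)] by blast
  obtain \<xi> where \<xi>: "\<not> isomorphic ar (code_structure r ar \<pi> \<xi>) ?N"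
    "equiv_rank r ar \<alpha>' (code_structure r ar \<pi> \<xi>) ?N"
    using approx \<alpha>'(1) by blast
  let ?M = "code_structure r ar \<pi> \<xi>" and ?z = "nat_ord r 0"
  \<comment> \<open>\<psi> says that no condition forces the copy into the orbit: every condition
    extends the empty one, whose domain is the ordinal 0. For the same reason \<psi> has no free
    variables.\<close>
  define \<psi> where "\<psi> = IForceNeg \<Phi> ?z"
  note neg = forcing_formulaD[OF forcing_formula_compl[OF FF \<alpha>'(3,2)]]
  have sat: "inf_sat M s \<psi> \<longleftrightarrow> (\<forall>\<gamma> t. inj_on t (underS r \<gamma>) \<longrightarrow> \<not> inf_sat M t (\<Phi> \<gamma>))"
    for M :: "'k lstruct" and s
  proof -
    have "(?z, \<gamma>) \<in> r" for \<gamma> using not_le_iff[of ?z] underS_nat_ord_0 by blast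
    then have "ext ?z s \<gamma> t \<longleftrightarrow> inj_on t (underS r \<gamma>)" for \<gamma> t
      by (simp add: ext_def underS_nat_ord_0 del: nat_ord.simps)
    then show ?thesis unfolding \<psi>_def IForceNeg_sat[where \<Phi> = \<Phi>, OF F(3)] by simp
  qed
  have "inf_sentence r ar \<psi>" "qr_le (cardSuc r) \<psi> \<alpha>'"
    using neg(2-4)[of ?z] by (auto simp: inf_sentence_def \<psi>_def underS_nat_ord_0 simp del: nat_ord.simps)
  then have equiv: "(\<forall>s. inf_sat ?M s \<psi>) \<longleftrightarrow> (\<forall>s. inf_sat ?N s \<psi>)"
    using \<xi>(2) by (simp add: equiv_rank_def)
  have generic: "\<exists>f. bij f \<and> (\<forall>x\<in>underS r \<gamma>. f x = t x) \<and>
      (can_code (pull M f) \<in> ?A \<longleftrightarrow> (\<exists>\<beta>. inf_sat M f (\<Phi> \<beta>)))"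
    if inj: "inj_on t (underS r \<gamma>)" for M :: "'k lstruct" and \<gamma> t
  proof -
    obtain \<D> where D: "|\<D>| \<le>o r" "\<And>D. D \<in> \<D> \<Longrightarrow> dense D" "\<And>D. D \<in> \<D> \<Longrightarrow> local D"
      "\<And>f. generic_for \<D> f \<Longrightarrow> can_code (pull M f) \<in> ?A \<longleftrightarrow> (\<exists>\<beta>. inf_sat M f (\<Phi> \<beta>))"
      using truth_lemmaE[OF F(6)[of M]] by metis
    obtain f where f: "bij f" "\<forall>x\<in>underS r \<gamma>. f x = t x" "\<forall>D\<in>\<D>. \<exists>\<gamma>. D \<gamma> f"
      using generic_bijection[OF D(1-3) inj] by iprover
    then have "generic_for \<D> f" by (simp add: generic_for_def)
    from D(4)[OF this] f(1,2) show ?thesis by iprover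
  qed
  \<comment> \<open>Every copy of \<open>?N\<close> lies in the orbit, so any sufficiently generic
    \<open>f\<close> shows that some condition forces this; hence \<psi> fails in \<open>?N\<close>,
    and by equivalence in \<open>?M\<close>.\<close>
  obtain f where f: "bij f" "can_code (pull ?N f) \<in> ?A \<longleftrightarrow> (\<exists>\<beta>. inf_sat ?N f (\<Phi> \<beta>))"
    using generic[of id ?z ?N] by auto
  then obtain \<beta> where "inf_sat ?N f (\<Phi> \<beta>)" using isomorphic_pull by blast
  moreover have "inj_on f (underS r \<beta>)" using f(1) by (auto simp: bij_def intro: inj_on_subset)
  ultimately have "\<not> (\<forall>s. inf_sat ?N s \<psi>)" unfolding sat by blast
  then obtain \<gamma> t where t: "inj_on t (underS r \<gamma>)" "inf_sat ?M t (\<Phi> \<gamma>)"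
    using equiv unfolding sat by blast
  obtain g where g: "bij g" "\<forall>x\<in>underS r \<gamma>. g x = t x"
    "can_code (pull ?M g) \<in> ?A \<longleftrightarrow> (\<exists>\<beta>. inf_sat ?M g (\<Phi> \<beta>))"
    using generic[OF t(1), of ?M] by blast
  \<comment> \<open>The bijection \<open>g\<close> agrees with \<open>t\<close> on all free
    variables of \<open>\<Phi> \<gamma>\<close>, so it inherits the forcing condition and its copy
    of \<open>?M\<close> falls into the orbit.\<close>
  have "inf_sat ?M g (\<Phi> \<gamma>)"
    using t(2) inf_sat_cong[of "\<Phi> \<gamma>" g t ?M] g(2) F(3) by blast
  then have "can_code (pull ?M g) \<in> ?A" using g(3) by blast
  then show False using isomorphic_of_pull[OF g(1)] \<xi>(1) by blast
qed

end
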